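(* Let $n\ge 1$, $V=\{1,\dots,n\}$, and let $W\in\mathbb{R}^{n\times n}$ have all diagonal entries equal to $1$ and satisfy $\|I-W\|<1$. Let $b=(b_1,\dots,b_n)^T$ be the vector of stand-alone optimal investments, i.e. $S_i'(b_i)=c_i$ for every $i\in V$. Let $p$ be any partition of $V$ and let $H_p$ be the averaging matrix of $p$. For an initial vector $x(0)\in\mathbb{R}^n$ with $x(0)\ge 0$, let $(x(t))_{t\ge 0}$ be defined by the best response dynamics $$x(t+1)=\max\bigl(0,(I-W)H_p\,x(t)+b\bigr),\qquad t=0,1,2,\dots$$ Then $\lim_{t\to\infty}x(t)$ exists and is independent of the initial vector $x(0)$.
   Context: $\|\cdot\|$ denotes the $\infty$-norm on vectors and the induced operator norm (maximum absolute row sum) on matrices. $I$ is the $n\times n$ identity matrix. For a vector $v$, $\max(0,v)$ is taken entrywise, and vector inequalities are entrywise. For each $i\in V$, $c_i>0$ is a constant and $S_i:[0,\infty)\to\mathbb{R}$ is a differentiable, strictly concave, strictly increasing function with $S_i'(0)>c_i$ and $\lim_{x\to\infty}S_i'(x)<c_i$; $b_i$ is the unique value with $S_i'(b_i)=c_i$ (so $b_i>0$). A partition of $V$ is a collection of non-empty pairwise disjoint subsets (blocks) of $V$ whose union is $V$. For a partition $p$, the averaging matrix $H_p\in\mathbb{R}^{n\times n}$ is defined by $(H_p)_{ij}=1/l_i$ if $i$ and $j$ belong to the same block of $p$, and $(H_p)_{ij}=0$ otherwise, where $l_i$ is the cardinality of the block containing $i$. *)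

theory Defs
  imports "HOL-Analysis.Analysis"
begin

text \<open>Vectors indexed by \<open>V = {1, \<dots>, n}\<close> are rendered as \<open>real ^ 'n\<close>, with \<open>n = CARD('n)\<close>.\<close>

definition strictly_concave_on :: "real set \<Rightarrow> (real \<Rightarrow> real) \<Rightarrow> bool"
  where "strictly_concave_on A f \<longleftrightarrow> convex A \<and>
    (\<forall>x\<in>A. \<forall>y\<in>A. x \<noteq> y \<longrightarrow>
      (\<forall>u. 0 < u \<and> u < 1 \<longrightarrow> (1 - u) * f x + u * f y < f ((1 - u) * x + u * y)))"

text \<open>The operator norm induced by \<^const>\<open>infnorm\<close>, in the style of \<^const>\<open>onorm\<close>
  (the point \<open>x = 0\<close> contributes \<open>0 / 0 = 0\<close>).\<close>

definition matrix_infnorm :: "real ^ 'n ^ 'n \<Rightarrow> real"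
  where "matrix_infnorm A = (SUP x. infnorm (A *v x) / infnorm x)"

lemma infnorm_le_iff_cart: "infnorm (x :: real ^ 'n) \<le> r \<longleftrightarrow> (\<forall>i. \<bar>x $ i\<bar> \<le> r)"
proof
  show "infnorm x \<le> r \<Longrightarrow> \<forall>i. \<bar>x $ i\<bar> \<le> r"
    using component_le_infnorm_cart order_trans by blast
  show "\<forall>i. \<bar>x $ i\<bar> \<le> r \<Longrightarrow> infnorm x \<le> r"
    unfolding infnorm_cart by (rule cSup_least) auto
qed

lemma matrix_infnorm_eq_row_sum:
  fixes A :: "real ^ 'n ^ 'n"
  shows "matrix_infnorm A = (MAX i. \<Sum>j\<in>UNIV. \<bar>A $ i $ j\<bar>)"
proof -
  define r where "r i = (\<Sum>j\<in>UNIV. \<bar>A $ i $ j\<bar>)" for i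
  define M where "M = (MAX i. r i)"
  have rM: "r i \<le> M" for i
    unfolding M_def by (rule Max_ge) auto
  have "M \<in> range r"
    unfolding M_def by (rule Max_in) auto
  then obtain k where k: "M = r k" by blast
  have r0: "0 \<le> r i" for i
    unfolding r_def by (simp add: sum_nonneg)
  have le: "infnorm (A *v x) / infnorm x \<le> M" for x
  proof (cases "x = 0")
    case True
    then show ?thesis using r0 k by (simp add: infnorm_0)
  next
    case False
    have "\<bar>(A *v x) $ i\<bar> \<le> M * infnorm x" for i
    proof -
      have "\<bar>(A *v x) $ i\<bar> \<le> (\<Sum>j\<in>UNIV. \<bar>A $ i $ j * x $ j\<bar>)"
        by (simp add: matrix_vector_mult_def sum_abs)
      also have "\<dots> \<le> (\<Sum>j\<in>UNIV. \<bar>A $ i $ j\<bar> * infnorm x)"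
        by (intro sum_mono) (simp add: abs_mult mult_left_mono component_le_infnorm_cart)
      also have "\<dots> = r i * infnorm x"
        by (simp add: r_def sum_distrib_right)
      also have "\<dots> \<le> M * infnorm x"
        by (simp add: mult_right_mono rM infnorm_pos_le)
      finally show ?thesis .
    qed
    then have "infnorm (A *v x) \<le> M * infnorm x"
      by (simp add: infnorm_le_iff_cart)
    with False show ?thesis
      by (simp add: divide_le_eq infnorm_pos_lt)
  qed
  define s :: "real ^ 'n" where "s = (\<chi> j. if A $ k $ j < 0 then - 1 else 1)"
  have s1: "\<bar>s $ j\<bar> = 1" for j by (simp add: s_def)
  have "infnorm s \<le> 1" by (simp add: infnorm_le_iff_cart s1)
  moreover have "1 \<le> infnorm s" using component_le_infnorm_cart[of s] by (simp add: s1)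
  ultimately have s: "infnorm s = 1" by simp
  have "(A *v s) $ k = M"
    unfolding k r_def s_def by (auto simp: matrix_vector_mult_def intro!: sum.cong)
  then have "M \<le> infnorm (A *v s) / infnorm s"
    using component_le_infnorm_cart[of "A *v s" k] s by simp
  also have "\<dots> \<le> matrix_infnorm A"
    unfolding matrix_infnorm_def by (rule cSUP_upper) (auto intro: bdd_aboveI[of _ M] le)
  finally have "M \<le> matrix_infnorm A" .
  moreover have "matrix_infnorm A \<le> M"
    unfolding matrix_infnorm_def by (rule cSUP_least) (auto intro: le)
  ultimately have "matrix_infnorm A = M" by simp
  then show ?thesis unfolding M_def r_def .
qed

definition block :: "'n set set \<Rightarrow> 'n \<Rightarrow> 'n set"
  where "block p i = (THE B. B \<in> p \<and> i \<in> B)"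

definition averaging_matrix :: "'n set set \<Rightarrow> real ^ 'n ^ 'n"
  where "averaging_matrix p =
    (\<chi> i j. if \<exists>B\<in>p. i \<in> B \<and> j \<in> B then 1 / real (card (block p i)) else 0)"

primrec best_response_dynamics ::
    "real ^ 'n ^ 'n \<Rightarrow> 'n set set \<Rightarrow> real ^ 'n \<Rightarrow> real ^ 'n \<Rightarrow> nat \<Rightarrow> real ^ 'n"
  where
    "best_response_dynamics W p b x0 0 = x0"
  | "best_response_dynamics W p b x0 (Suc t) =
      (\<chi> i. max 0 ((((mat 1 - W) ** averaging_matrix p) *v best_response_dynamics W p b x0 t + b) $ i))"

end

theory Submission
  imports Defs
begin

text \<open>Averaging over blocks does not increase the \<open>\<infinity>\<close>-norm and the positive part is
  1-Lipschitz, so the best response map is a contraction of factor \<open>\<parallel>I - W\<parallel> < 1\<close> in the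
  \<open>\<infinity>\<close>-norm.\<close>

text \<open>Banach's fixed point argument, with the contraction measured by \<open>infnorm\<close>
  and the limit taken in the Euclidean norm; equivalence of the two norms costs only a constant
  factor. The orbit of 0 converges because its increments decay geometrically, and it attracts every
  other orbit.\<close>

lemma infnorm_contraction_iterates_converge:
  fixes f :: "'a::euclidean_space \<Rightarrow> 'a"
  assumes k: "0 \<le> k" "k < 1"
    and contr: "\<And>x y. infnorm (f x - f y) \<le> k * infnorm (x - y)"
  shows "\<exists>l. \<forall>x. (\<lambda>t. (f ^^ t) x) \<longlonglongrightarrow> l"
proof -
  \<comment> \<open>The factor \<open>sqrt DIM('a)\<close> is the price of bounding
    \<open>norm\<close> by \<open>infnorm\<close>.\<close>
  define C where "C x y = sqrt DIM('a) * infnorm (x - y)" for x y :: 'a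
  have iter: "infnorm ((f ^^ t) x - (f ^^ t) y) \<le> k ^ t * infnorm (x - y)" for t x y
  proof (induction t)
    case (Suc t)
    have "infnorm ((f ^^ Suc t) x - (f ^^ Suc t) y) \<le> k * infnorm ((f ^^ t) x - (f ^^ t) y)"
      by (simp add: contr)
    also have "\<dots> \<le> k * (k ^ t * infnorm (x - y))"
      using Suc k by (intro mult_left_mono)
    finally show ?case by (simp add: mult.assoc)
  qed simp
  have bound: "norm ((f ^^ t) x - (f ^^ t) y) \<le> C x y * k ^ t" for t x y
  proof -
    have "norm ((f ^^ t) x - (f ^^ t) y) \<le> sqrt DIM('a) * infnorm ((f ^^ t) x - (f ^^ t) y)"
      by (rule norm_le_infnorm)
    also have "\<dots> \<le> sqrt DIM('a) * (k ^ t * infnorm (x - y))"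
      by (intro mult_left_mono iter) simp
    finally show ?thesis by (simp add: C_def mult_ac)
  qed
  \<comment> \<open>The increment at time \<open>t\<close> is the gap between the orbits started at
    \<open>f 0\<close> and at \<open>0\<close>, so the two-orbit bound applies.\<close>
  have "norm ((f ^^ Suc t) 0 - (f ^^ t) 0) \<le> C (f 0) 0 * k ^ t" for t
    using bound[of t "f 0" 0] by (simp add: funpow_swap1)
  then have "summable (\<lambda>t. (f ^^ Suc t) 0 - (f ^^ t) 0)"
    by (rule summable_comparison_test'[rotated]) (use k in \<open>intro summable_mult summable_geometric, simp\<close>)
  \<comment> \<open>The partial sums of the increments telescope.\<close>
  then have "convergent (\<lambda>t. (f ^^ t) 0 - (f ^^ 0) 0)"
    unfolding summable_iff_convergent sum_lessThan_telescope[where f = "\<lambda>t. (f ^^ t) 0"] .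
  then obtain l where l: "(\<lambda>t. (f ^^ t) 0) \<longlonglongrightarrow> l"
    by (auto simp: convergent_diff_const_right_iff convergent_def)
  have "(\<lambda>t. (f ^^ t) x) \<longlonglongrightarrow> l" for x
  proof -
    have "(\<lambda>t. C x 0 * k ^ t) \<longlonglongrightarrow> 0"
      using k by (intro tendsto_mult_right_zero LIMSEQ_realpow_zero)
    then have "(\<lambda>t. (f ^^ t) x - (f ^^ t) 0) \<longlonglongrightarrow> 0"
      by (rule Lim_null_comparison[rotated]) (simp add: bound)
    from tendsto_add[OF this l] show ?thesis by simp
  qed
  then show ?thesis by blast
qed

lemma matrix_infnorm_nonneg: "0 \<le> matrix_infnorm (A :: real ^ 'n ^ 'n)"
proof -
  have "0 \<le> (\<Sum>j\<in>UNIV. \<bar>A $ i $ j\<bar>)" for i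
    by (simp add: sum_nonneg)
  also have "(\<Sum>j\<in>UNIV. \<bar>A $ i $ j\<bar>) \<le> matrix_infnorm A" for i
    unfolding matrix_infnorm_eq_row_sum by (rule Max_ge) auto
  finally show ?thesis by blast
qed

text \<open>Each entry of \<open>A *v x\<close> is at most its absolute row sum times
  \<open>infnorm x\<close>, and \<open>matrix_infnorm A\<close> is the largest row sum.\<close>

lemma infnorm_matrix_vector_mult_le:
  fixes A :: "real ^ 'n ^ 'n"
  shows "infnorm (A *v x) \<le> matrix_infnorm A * infnorm x"
proof -
  have "\<bar>(A *v x) $ i\<bar> \<le> matrix_infnorm A * infnorm x" for i
  proof -
    have "\<bar>(A *v x) $ i\<bar> \<le> (\<Sum>j\<in>UNIV. \<bar>A $ i $ j * x $ j\<bar>)"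
      by (simp add: matrix_vector_mult_def sum_abs)
    also have "\<dots> \<le> (\<Sum>j\<in>UNIV. \<bar>A $ i $ j\<bar> * infnorm x)"
      by (intro sum_mono) (simp add: abs_mult mult_left_mono component_le_infnorm_cart)
    also have "\<dots> = (\<Sum>j\<in>UNIV. \<bar>A $ i $ j\<bar>) * infnorm x"
      by (simp add: sum_distrib_right)
    also have "\<dots> \<le> matrix_infnorm A * infnorm x"
      unfolding matrix_infnorm_eq_row_sum
      by (intro mult_right_mono Max_ge) (auto simp: infnorm_pos_le)
    finally show ?thesis .
  qed
  then show ?thesis
    by (simp add: infnorm_le_iff_cart)
qed

text \<open>Disjointness of the blocks makes the description in \<open>block\<close> unique.\<close>

lemma block_eq:
  assumes "partition_on A p" "B \<in> p" "i \<in> B"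
  shows "block p i = B"
  unfolding block_def
proof (rule the_equality)
  show "B \<in> p \<and> i \<in> B" using assms by simp
  show "B' = B" if "B' \<in> p \<and> i \<in> B'" for B'
    using that assms by (auto simp: partition_on_def disjoint_def)
qed

lemma averaging_matrix_row_sum:
  fixes p :: "('n::finite) set set"
  assumes "partition_on UNIV p"
  shows "(\<Sum>j\<in>UNIV. \<bar>averaging_matrix p $ i $ j\<bar>) = 1"
proof -
  obtain B where B: "B \<in> p" "i \<in> B"
    using partition_onD1[OF assms] by (metis UNIV_I UnionE)
  have row: "averaging_matrix p $ i $ j = (if j \<in> B then 1 / card B else 0)" for j
  proof -
    have "(\<exists>B\<in>p. i \<in> B \<and> j \<in> B) \<longleftrightarrow> j \<in> B"
      using B block_eq[OF assms] by metis
    then show ?thesis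
      by (simp add: averaging_matrix_def block_eq[OF assms B])
  qed
  \<comment> \<open>This excludes the default \<open>1 / 0 = 0\<close>: the row has
    \<open>card B\<close> entries equal to \<open>1 / card B\<close>, which then sum to 1.\<close>
  have "card B \<noteq> 0" using B by auto
  then show ?thesis
    by (simp add: row if_distrib sum.If_cases cong: if_cong)
qed

text \<open>Lets the averaging step drop out of the contraction estimate, whatever the
  partition.\<close>

lemma matrix_infnorm_averaging_matrix:
  assumes "partition_on UNIV p"
  shows "matrix_infnorm (averaging_matrix p) = 1"
  by (simp add: matrix_infnorm_eq_row_sum averaging_matrix_row_sum[OF assms])

theorem theorem1:
  fixes W :: "real ^ 'n ^ 'n"
    and b :: "real ^ 'n"
    and c :: "'n \<Rightarrow> real"
    and S S' :: "'n \<Rightarrow> real \<Rightarrow> real"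
    and p :: "'n set set"
  assumes "\<And>i. W $ i $ i = 1"
    and "matrix_infnorm (mat 1 - W) < 1"
    and "\<And>i. 0 < c i"
    and "\<And>i x. 0 \<le> x \<Longrightarrow> (S i has_real_derivative S' i x) (at x within {0..})"
    and "\<And>i. strictly_concave_on {0..} (S i)"
    and "\<And>i. strict_mono_on {0..} (S i)"
    and "\<And>i. c i < S' i 0"
    and "\<And>i. \<exists>l. (S' i \<longlongrightarrow> l) at_top \<and> l < c i"
    and "\<And>i. 0 \<le> b $ i \<and> S' i (b $ i) = c i"
    and "partition_on UNIV p"
  shows "\<exists>l. \<forall>x0. 0 \<le> x0 \<longrightarrow> best_response_dynamics W p b x0 \<longlonglongrightarrow> l"
proof -
  define A where "A = mat 1 - W"
  define H where "H = averaging_matrix p"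
  define f :: "real ^ 'n \<Rightarrow> real ^ 'n" where "f x = (\<chi> i. max 0 (((A ** H) *v x + b) $ i))" for x
  have "infnorm (f x - f y) \<le> matrix_infnorm A * infnorm (x - y)" for x y
  proof -
    have "\<bar>(f x - f y) $ i\<bar> \<le> infnorm ((A ** H) *v (x - y))" for i
    proof -
      \<comment> \<open>The map \<open>max 0\<close> is 1-Lipschitz, and \<open>b\<close> cancels in
        the difference of its arguments.\<close>
      have "\<bar>(f x - f y) $ i\<bar> \<le> \<bar>((A ** H) *v (x - y)) $ i\<bar>"
        by (simp add: f_def matrix_vector_mult_diff_distrib)
      also have "\<dots> \<le> infnorm ((A ** H) *v (x - y))"
        by (rule component_le_infnorm_cart)
      finally show ?thesis .
    qed
    then have "infnorm (f x - f y) \<le> infnorm (A *v (H *v (x - y)))"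
      by (simp add: infnorm_le_iff_cart matrix_vector_mul_assoc)
    also have "\<dots> \<le> matrix_infnorm A * infnorm (H *v (x - y))"
      by (rule infnorm_matrix_vector_mult_le)
    also have "\<dots> \<le> matrix_infnorm A * infnorm (x - y)"
      using infnorm_matrix_vector_mult_le[of H "x - y"] matrix_infnorm_averaging_matrix[OF assms(10)]
      by (intro mult_left_mono matrix_infnorm_nonneg) (simp add: H_def)
    finally show ?thesis .
  qed
  moreover have "matrix_infnorm A < 1"
    using assms(2) by (simp add: A_def)
  ultimately obtain l where l: "\<And>x. (\<lambda>t. (f ^^ t) x) \<longlonglongrightarrow> l"
    using infnorm_contraction_iterates_converge[OF matrix_infnorm_nonneg] by blast
  \<comment> \<open>Both recursions apply the new step outermost, so the dynamics are the iterates
    of \<open>f\<close>, whose limit \<open>l\<close> was fixed before \<open>x0\<close>.\<close>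
  have "best_response_dynamics W p b x0 t = (f ^^ t) x0" for x0 t
    by (induction t) (simp_all add: f_def A_def H_def)
  then have "best_response_dynamics W p b x0 = (\<lambda>t. (f ^^ t) x0)" for x0
    by blast
  with l show ?thesis by metis
qed

end
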